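(* Let $X$ be an uncountable regular open Whyburn space. The following are equivalent: (1) $X$ satisfies $S_1(\Omega^s,\Omega^s)$; (2) $X$ satisfies $S_1(\mathcal{K}_{\Omega},\mathcal{K}_{\Omega})$; (3) $vet_1(\mathbf{0},Q_p(X,\mathbb{R}))=\omega$; (4) $vet_1(f,Q_p(X,\mathbb{R}))=\omega$ for every continuous $f:X\to\mathbb{R}$; (5) $vet_1(Q_p(X,\mathbb{D}))=\omega$.
   Context: All spaces are assumed regular. A function $f:X\to Y$ is quasicontinuous if for every $x\in X$, every open $V\ni f(x)$ and every open $U\ni x$ there is a nonempty open $W\subseteq U$ with $f(W)\subseteq V$. $Q_p(X,Y)$ is the set of all quasicontinuous functions $X\to Y$ with the topology of pointwise convergence; $\mathbb{D}=\{0,1\}$ is discrete; $\mathbf{0}$ is the constant zero function. $X$ is open Whyburn if for every open $A\subseteq X$ and every $x\in\overline{A}\setminus A$ there is an open $B\subseteq A$ with $\overline{B}\setminus A=\{x\}$. A set $A$ is minimally bounded if $A\subseteq\overline{\mathrm{Int}A}$ and $\mathrm{Int}\overline{A}\subseteq A$. $\Omega^s$ is the collection of covers of $X$ by minimally bounded sets which are $\omega$-covers (every finite subset of $X$ lies in some member). $\mathcal{K}_\Omega$ is the set of families $\mathcal{U}$ of open subsets of $X$ with $X=\bigcup\{\overline{U}:U\in\mathcal{U}\}$, no element of $\mathcal{U}$ dense in $X$, and for each finite $F\subseteq X$ some $U\in\mathcal{U}$ with $F\subseteq\overline{U}$. $S_1(\mathcal{A},\mathcal{B})$: for every sequence $(A_n)_{n\in\mathbb{N}}$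 of elements of $\mathcal{A}$ there are $b_n\in A_n$ with $\{b_n:n\in\mathbb{N}\}\in\mathcal{B}$. For a space $Z$ and $z\in Z$, $vet_1(z,Z)=\omega$ means: for every sequence $(A_n)_{n\in\omega}$ of subsets of $Z$ with $z\in\bigcap_n\overline{A_n}$ there are $a_n\in A_n$ with $z\in\overline{\{a_n:n\in\omega\}}$; $vet_1(Z)=\omega$ means this holds for all $z\in Z$. *)

theory Defs
  imports "HOL-Analysis.Analysis"
begin

definition quasicontinuous_map :: "'a topology \<Rightarrow> 'b topology \<Rightarrow> ('a \<Rightarrow> 'b) \<Rightarrow> bool" where
  "quasicontinuous_map X Y f \<longleftrightarrow>
     f ` topspace X \<subseteq> topspace Y \<and>
     (\<forall>x \<in> topspace X. \<forall>V U. openin Y V \<and> f x \<in> V \<and> openin X U \<and> x \<in> U \<longrightarrow>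
        (\<exists>W. openin X W \<and> W \<noteq> {} \<and> W \<subseteq> U \<and> f ` W \<subseteq> V))"

text \<open>Q_p(X,Y): quasicontinuous functions with the topology of pointwise convergence,
  realised as a subspace of the product topology (functions are extensional on topspace X).\<close>
definition Qp :: "'a topology \<Rightarrow> 'b topology \<Rightarrow> ('a \<Rightarrow> 'b) topology" where
  "Qp X Y = subtopology (product_topology (\<lambda>_. Y) (topspace X))
      {f \<in> topspace (product_topology (\<lambda>_. Y) (topspace X)). quasicontinuous_map X Y f}"

definition D2 :: "real topology" where
  "D2 = discrete_topology {0, 1}"

definition open_whyburn :: "'a topology \<Rightarrow> bool" where
  "open_whyburn X \<longleftrightarrow>
     (\<forall>A. openin X A \<longrightarrow> (\<forall>x \<in> X closure_of A - A.
        \<exists>B. openin X B \<and> B \<subseteq> A \<and> X closure_of B - A = {x}))"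

definition minimally_bounded :: "'a topology \<Rightarrow> 'a set \<Rightarrow> bool" where
  "minimally_bounded X A \<longleftrightarrow>
     A \<subseteq> X closure_of (X interior_of A) \<and> X interior_of (X closure_of A) \<subseteq> A"

definition Omega_s :: "'a topology \<Rightarrow> 'a set set set" where
  "Omega_s X = {\<U>. \<Union>\<U> = topspace X \<and> (\<forall>A \<in> \<U>. A \<subseteq> topspace X \<and> minimally_bounded X A) \<and>
      (\<forall>F. finite F \<and> F \<subseteq> topspace X \<longrightarrow> (\<exists>A \<in> \<U>. F \<subseteq> A))}"

definition K_Omega :: "'a topology \<Rightarrow> 'a set set set" where
  "K_Omega X = {\<U>. (\<forall>U \<in> \<U>. openin X U) \<and>
      topspace X = \<Union>{X closure_of U | U. U \<in> \<U>} \<and>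
      (\<forall>U \<in> \<U>. X closure_of U \<noteq> topspace X) \<and>
      (\<forall>F. finite F \<and> F \<subseteq> topspace X \<longrightarrow> (\<exists>U \<in> \<U>. F \<subseteq> X closure_of U))}"

definition S1 :: "'b set set set \<Rightarrow> 'b set set set \<Rightarrow> bool" where
  "S1 \<A> \<B> \<longleftrightarrow> (\<forall>A :: nat \<Rightarrow> 'b set set. (\<forall>n. A n \<in> \<A>) \<longrightarrow>
      (\<exists>b. (\<forall>n. b n \<in> A n) \<and> range b \<in> \<B>))"

definition vet1_at :: "'c topology \<Rightarrow> 'c \<Rightarrow> bool" where
  "vet1_at Z z \<longleftrightarrow> (\<forall>A :: nat \<Rightarrow> 'c set.
      (\<forall>n. A n \<subseteq> topspace Z \<and> z \<in> Z closure_of (A n)) \<longrightarrow>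
      (\<exists>a. (\<forall>n. a n \<in> A n) \<and> z \<in> Z closure_of (range a)))"

definition vet1 :: "'c topology \<Rightarrow> bool" where
  "vet1 Z \<longleftrightarrow> (\<forall>z \<in> topspace Z. vet1_at Z z)"

end

theory Submission
  imports Defs
begin

text \<open>
  The open Whyburn property shrinks an open set \<open>A\<close> with a finite set \<open>F\<close> in its closure to an open
  \<open>B \<subseteq> A\<close> with \<open>F \<subseteq> cl B \<subseteq> A \<union> F\<close>. As the preimage of an open set under a quasicontinuous map lies
  in the closure of its interior, a condition on finitely many values of such a map can thereby be
  replaced by a condition on the closure of an open set, and these sets form families to which
  \<open>S\<^sub>1(\<K>\<^sub>\<Omega>, \<K>\<^sub>\<Omega>)\<close> applies. In the other direction, the functions that vanish on \<open>cl U\<close> and are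
  \<open>1\<close> elsewhere are quasicontinuous.

  The delicate case is the tightness of the two-valued functions at a discontinuous \<open>f\<close>, where the
  set on which two quasicontinuous functions agree need not lie in the closure of its interior. Put
  \<open>P = int {f = 1}\<close> and \<open>Q = int {f = 0}\<close>. The selection principle makes the nowhere dense set
  \<open>N = X - (P \<union> Q)\<close> countable and exhausts \<open>P \<union> Q\<close> by open sets \<open>E\<^sub>n\<close> with \<open>cl E\<^sub>n \<subseteq> P \<union> Q\<close>. At stage
  \<open>n\<close> one requires agreement with \<open>f\<close> on the first \<open>n\<close> points of \<open>N\<close> outright, and selects only for
  agreement on \<open>E\<^sub>n\<close>: adding \<open>X - cl E\<^sub>n\<close> to an open set covers \<open>N\<close> without affecting \<open>E\<^sub>n\<close>.
\<close>

section \<open>Selecting from families of open sets\<close>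

definition K_omega_family :: "'a topology \<Rightarrow> 'a set set \<Rightarrow> bool" where
  "K_omega_family X \<W> \<longleftrightarrow> (\<forall>W\<in>\<W>. openin X W) \<and>
     (\<forall>F. finite F \<and> F \<subseteq> topspace X \<longrightarrow> (\<exists>W\<in>\<W>. F \<subseteq> X closure_of W))"

lemma Union_closures_eq_topspace:
  assumes "\<And>F. finite F \<Longrightarrow> F \<subseteq> topspace X \<Longrightarrow> \<exists>W\<in>\<W>. F \<subseteq> X closure_of W"
  shows "topspace X = \<Union>{X closure_of W | W. W \<in> \<W>}"
proof
  show "topspace X \<subseteq> \<Union>{X closure_of W | W. W \<in> \<W>}"
  proof
    fix x assume "x \<in> topspace X"
    then obtain W where "W \<in> \<W>" "{x} \<subseteq> X closure_of W"
      using assms[of "{x}"] by auto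
    then show "x \<in> \<Union>{X closure_of W | W. W \<in> \<W>}"
      by auto
  qed
  show "\<Union>{X closure_of W | W. W \<in> \<W>} \<subseteq> topspace X"
    using closure_of_subset_topspace by fastforce
qed

lemma K_Omega_eq:
  "K_Omega X = {\<W>. K_omega_family X \<W> \<and> (\<forall>W\<in>\<W>. X closure_of W \<noteq> topspace X)}"
proof -
  have "topspace X = \<Union>{X closure_of W | W. W \<in> \<W>}"
    if "\<forall>F. finite F \<and> F \<subseteq> topspace X \<longrightarrow> (\<exists>W\<in>\<W>. F \<subseteq> X closure_of W)" for \<W>
    using Union_closures_eq_topspace[of X \<W>] that by simp
  then show ?thesis
    unfolding K_Omega_def K_omega_family_def by (intro Collect_cong) iprover
qed

lemma K_OmegaD:
  assumes "\<U> \<in> K_Omega X"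
  shows "\<And>U. U \<in> \<U> \<Longrightarrow> openin X U"
    and "\<And>U. U \<in> \<U> \<Longrightarrow> X closure_of U \<noteq> topspace X"
    and "\<And>F. finite F \<Longrightarrow> F \<subseteq> topspace X \<Longrightarrow> \<exists>U\<in>\<U>. F \<subseteq> X closure_of U"
  using assms by (simp_all add: K_Omega_eq K_omega_family_def)

lemma Omega_sD:
  assumes "\<U> \<in> Omega_s X"
  shows "\<And>A. A \<in> \<U> \<Longrightarrow> A \<subseteq> topspace X"
    and "\<And>A. A \<in> \<U> \<Longrightarrow> minimally_bounded X A"
    and "\<And>F. finite F \<Longrightarrow> F \<subseteq> topspace X \<Longrightarrow> \<exists>A\<in>\<U>. F \<subseteq> A"
  using assms by (simp_all add: Omega_s_def)

text \<open>Families with dense members are allowed here: if infinitely many of them have one,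
  those members form the selection; otherwise a tail lies in \<^term>\<open>K_Omega X\<close>, and adding to \<open>F\<close>
  a point outside each of the first closures forces a large index.\<close>

lemma S1_K_Omega_select:
  assumes S1: "S1 (K_Omega X) (K_Omega X)"
    and W: "\<And>n. K_omega_family X (\<W> n)"
  obtains w where "\<And>n. w n \<in> \<W> n"
    and "\<And>F m. finite F \<Longrightarrow> F \<subseteq> topspace X \<Longrightarrow> \<exists>n\<ge>m::nat. F \<subseteq> X closure_of (w n)"
proof -
  have ne: "\<exists>w. w \<in> \<W> n" for n
    using W[of n] unfolding K_omega_family_def by (metis finite.emptyI empty_subsetI)
  show thesis
  proof (cases "\<forall>m::nat. \<exists>n\<ge>m. \<exists>w\<in>\<W> n. X closure_of w = topspace X")
    case True
    define w where "w n = (SOME w. w \<in> \<W> n \<and>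
      ((\<exists>w\<in>\<W> n. X closure_of w = topspace X) \<longrightarrow> X closure_of w = topspace X))" for n
    have w: "w n \<in> \<W> n \<and>
      ((\<exists>w\<in>\<W> n. X closure_of w = topspace X) \<longrightarrow> X closure_of (w n) = topspace X)" for n
      unfolding w_def by (rule someI_ex) (use ne in blast)
    show thesis
    proof (rule that)
      show "w n \<in> \<W> n" for n
        using w by blast
      show "\<exists>n\<ge>m. F \<subseteq> X closure_of (w n)" if "F \<subseteq> topspace X" for F m
        using True w that by metis
    qed
  next
    case False
    then obtain N where N: "\<And>n w. n \<ge> N \<Longrightarrow> w \<in> \<W> n \<Longrightarrow> X closure_of w \<noteq> topspace X"
      by blast
    have "\<W> (N + k) \<in> K_Omega X" for k
      using W N[of "N + k"] by (simp add: K_Omega_eq)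
    then obtain b where b: "\<And>k. b k \<in> \<W> (N + k)" and rb: "range b \<in> K_Omega X"
      using S1[unfolded S1_def, rule_format, of "\<lambda>k. \<W> (N + k)"] by blast
    \<comment> \<open>\<open>b\<close> is indexed from stage \<open>N\<close> on. The first
      \<open>N\<close> choices are arbitrary members, since finite sets get covered at the indices
      \<open>N + k\<close> only.\<close>
    define w where "w n = (if n < N then SOME w. w \<in> \<W> n else b (n - N))" for n
    have nd: "\<exists>x. x \<in> topspace X \<and> x \<notin> X closure_of (b k)" for k
      using N[OF _ b[of k]] closure_of_subset_topspace[of X "b k"] by auto
    then obtain x where x: "\<And>k. x k \<in> topspace X" "\<And>k. x k \<notin> X closure_of (b k)"
      by metis
    show thesis
    proof (rule that)
      show "w n \<in> \<W> n" for n
        using b[of "n - N"] someI_ex[OF ne[of n]] by (auto simp: w_def)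
      fix F m assume "finite F" "F \<subseteq> topspace X"
      then have "finite (F \<union> x ` {..<m})" "F \<union> x ` {..<m} \<subseteq> topspace X"
        using x by auto
      then obtain k where k: "F \<union> x ` {..<m} \<subseteq> X closure_of (b k)"
        using K_OmegaD(3)[OF rb] by blast
      then have "k \<ge> m"
        using x(2)[of k] by (meson UnI2 image_eqI lessThan_iff not_le_imp_less subsetD)
      then show "\<exists>n\<ge>m. F \<subseteq> X closure_of (w n)"
        using k by (intro exI[of _ "N + k"]) (auto simp: w_def)
    qed
  qed
qed

section \<open>Shrinking open sets while keeping finitely many points in the closure\<close>

lemma regular_space_openin_shrink:
  assumes "regular_space X" "openin X U" "x \<in> U"
  obtains V where "openin X V" "x \<in> V" "X closure_of V \<subseteq> U"
proof -
  obtain V C where "openin X V" "closedin X C" "x \<in> V" "V \<subseteq> C" "C \<subseteq> U"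
    using assms neighbourhood_base_of_closedin[of X] unfolding neighbourhood_base_of by metis
  then show thesis
    using that closure_of_minimal by (metis order_trans)
qed

text \<open>Argue point by point. A point of \<open>F\<close> in \<open>A\<close> has by regularity
  a neighbourhood whose closure stays in \<open>A\<close>; for a point of \<open>F\<close> outside
  \<open>A\<close>, the open Whyburn property gives an open subset of \<open>A\<close> whose closure
  leaves \<open>A\<close> in that point alone. As \<open>F\<close> is finite, the closure of the
  union is the union of the closures.\<close>

lemma open_whyburn_shrink:
  assumes "regular_space X" "open_whyburn X" "openin X A" "finite F" "F \<subseteq> X closure_of A"
  obtains B where "openin X B" "B \<subseteq> A" "F \<subseteq> X closure_of B" "X closure_of B \<subseteq> A \<union> F"
proof -
  have "\<exists>B. openin X B \<and> B \<subseteq> A \<and> y \<in> X closure_of B \<and> X closure_of B \<subseteq> insert y A"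
    if "y \<in> F" for y
  proof (cases "y \<in> A")
    case True
    then obtain V where "openin X V" "y \<in> V" "X closure_of V \<subseteq> A"
      using regular_space_openin_shrink assms by metis
    moreover have "V \<subseteq> X closure_of V"
      using \<open>openin X V\<close> by (simp add: closure_of_subset openin_subset)
    ultimately show ?thesis by blast
  next
    case False
    then have "y \<in> X closure_of A - A"
      using assms(5) that by blast
    then obtain B where "openin X B" "B \<subseteq> A" "X closure_of B - A = {y}"
      using assms(2,3) unfolding open_whyburn_def by meson
    then show ?thesis by blast
  qed
  then obtain B where B: "\<And>y. y \<in> F \<Longrightarrow> openin X (B y) \<and> B y \<subseteq> A \<and> y \<in> X closure_of (B y)
      \<and> X closure_of (B y) \<subseteq> insert y A"
    by metis
  have cl: "X closure_of (\<Union>y\<in>F. B y) = (\<Union>y\<in>F. X closure_of (B y))"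
    using closure_of_Union[of "B ` F" X] \<open>finite F\<close> by auto
  show thesis
  proof (rule that)
    show "openin X (\<Union>y\<in>F. B y)"
      using B by blast
  qed (use B cl in blast)+
qed

section \<open>Covers by minimally bounded sets\<close>

lemma minimally_bounded_closure_of_open:
  assumes "openin X U"
  shows "minimally_bounded X (X closure_of U)"
proof -
  have "U \<subseteq> X interior_of (X closure_of U)"
    using assms by (simp add: closure_of_subset interior_of_maximal openin_subset)
  then show ?thesis
    unfolding minimally_bounded_def
    by (simp add: closure_of_mono interior_of_subset)
qed

text \<open>Closures of open sets are minimally bounded, so taking closures turns each
  \<open>A n\<close> into a member of \<open>Omega_s X\<close>. Choosing for each selected closure
  an open set of \<open>A n\<close> that produces it carries the selection back.\<close>

lemma S1_Omega_s_imp_K_Omega: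
  assumes "S1 (Omega_s X) (Omega_s X)"
  shows "S1 (K_Omega X) (K_Omega X)"
  unfolding S1_def
proof (intro allI impI)
  fix A :: "nat \<Rightarrow> 'a set set"
  assume A: "\<forall>n. A n \<in> K_Omega X"
  have "(closure_of) X ` A n \<in> Omega_s X" for n
  proof -
    note D = K_OmegaD[OF A[rule_format, of n]]
    have "\<Union>((closure_of) X ` A n) = \<Union>{X closure_of U | U. U \<in> A n}"
      by auto
    also have "\<dots> = topspace X"
      using Union_closures_eq_topspace[OF D(3)] by simp
    finally have "\<Union>((closure_of) X ` A n) = topspace X" .
    then show ?thesis
      unfolding Omega_s_def
      by (simp add: D(1,3) minimally_bounded_closure_of_open closure_of_subset_topspace)
  qed
  then obtain c where c: "\<And>n. c n \<in> (closure_of) X ` A n" and rc: "range c \<in> Omega_s X"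
    using assms[unfolded S1_def, rule_format, of "\<lambda>n. (closure_of) X ` A n"] by blast
  have "\<forall>n. \<exists>u. u \<in> A n \<and> c n = X closure_of u"
    using c by blast
  then obtain b where b: "\<And>n. b n \<in> A n" "\<And>n. c n = X closure_of (b n)"
    by metis
  have "openin X (b n)" "X closure_of (b n) \<noteq> topspace X" for n
    using K_OmegaD(1,2)[OF A[rule_format] b(1)] by blast+
  moreover have "\<forall>F. finite F \<and> F \<subseteq> topspace X \<longrightarrow> (\<exists>n. F \<subseteq> X closure_of (b n))"
    using Omega_sD(3)[OF rc] b(2) by fastforce
  ultimately have "range b \<in> K_Omega X"
    unfolding K_Omega_eq K_omega_family_def by simp
  with b show "\<exists>b. (\<forall>n. b n \<in> A n) \<and> range b \<in> K_Omega X"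
    by blast
qed

lemma S1_K_Omega_imp_Omega_s:
  assumes "regular_space X" "open_whyburn X" "S1 (K_Omega X) (K_Omega X)"
  shows "S1 (Omega_s X) (Omega_s X)"
  unfolding S1_def
proof (intro allI impI)
  fix A :: "nat \<Rightarrow> 'a set set"
  assume A: "\<forall>n. A n \<in> Omega_s X"
  \<comment> \<open>The closure of \<open>B\<close>, not just \<open>B\<close>, has to fit into a
    member of \<open>A n\<close>, because the selection captures finite sets by closures. Such
    \<open>B\<close> exist: \<open>F\<close> lies in \<open>a\<close>, hence in the closure of the
    interior of \<open>a\<close>, and shrinking that interior adds only points of
    \<open>F\<close>.\<close>
  define \<W> where "\<W> n = {B. openin X B \<and> (\<exists>a\<in>A n. X closure_of B \<subseteq> a)}" for n
  have "\<exists>W\<in>\<W> n. F \<subseteq> X closure_of W" if F: "finite F" "F \<subseteq> topspace X" for F n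
  proof -
    obtain a where a: "a \<in> A n" "F \<subseteq> a"
      using Omega_sD(3)[OF A[rule_format] F] by blast
    then have "a \<subseteq> X closure_of (X interior_of a)"
      using Omega_sD(2)[OF A[rule_format]] unfolding minimally_bounded_def by blast
    then obtain B where "openin X B" "F \<subseteq> X closure_of B" "X closure_of B \<subseteq> X interior_of a \<union> F"
      using open_whyburn_shrink[OF assms(1,2) openin_interior_of \<open>finite F\<close>] a(2)
      by (metis order_trans)
    then show ?thesis
      using a interior_of_subset[of X a] unfolding \<W>_def by blast
  qed
  then have "K_omega_family X (\<W> n)" for n
    unfolding K_omega_family_def \<W>_def by simp
  then obtain w where w: "\<And>n. w n \<in> \<W> n"
    and wF: "\<And>F m. finite F \<Longrightarrow> F \<subseteq> topspace X \<Longrightarrow> \<exists>n\<ge>m::nat. F \<subseteq> X closure_of (w n)"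
    using S1_K_Omega_select[OF assms(3)] by metis
  then obtain a where a: "\<And>n. a n \<in> A n" "\<And>n. X closure_of (w n) \<subseteq> a n"
    unfolding \<W>_def by (simp, metis)
  have cov: "\<exists>b\<in>range a. F \<subseteq> b" if "finite F" "F \<subseteq> topspace X" for F
    using wF[OF that] a(2) by (meson order_trans rangeI)
  have sub: "a n \<subseteq> topspace X \<and> minimally_bounded X (a n)" for n
    using Omega_sD(1,2)[OF A[rule_format] a(1)] by blast
  have "topspace X \<subseteq> \<Union>(range a)"
  proof
    fix x assume "x \<in> topspace X"
    then show "x \<in> \<Union>(range a)"
      using cov[of "{x}"] by auto
  qed
  then have "range a \<in> Omega_s X"
    using sub cov unfolding Omega_s_def by blast
  with a show "\<exists>b. (\<forall>n. b n \<in> A n) \<and> range b \<in> Omega_s X"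
    by blast
qed

section \<open>Pointwise convergence of quasicontinuous functions\<close>

lemma in_topspace_Qp:
  "f \<in> topspace (Qp X Y) \<longleftrightarrow> f \<in> extensional (topspace X) \<and> quasicontinuous_map X Y f"
  unfolding Qp_def quasicontinuous_map_def by (auto simp: PiE_iff)

text \<open>Basic open sets of the product constrain finitely many coordinates. This reduces every
  closure argument below to a condition on a finite set of points.\<close>

lemma in_closure_of_Qp:
  assumes "A \<subseteq> topspace (Qp X Y)"
  shows "z \<in> Qp X Y closure_of A \<longleftrightarrow> z \<in> topspace (Qp X Y) \<and>
    (\<forall>F V. finite F \<and> F \<subseteq> topspace X \<and> (\<forall>x\<in>F. openin Y (V x) \<and> z x \<in> V x) \<longrightarrow>
      (\<exists>a\<in>A. \<forall>x\<in>F. a x \<in> V x))" (is "_ \<longleftrightarrow> _ \<and> ?R")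
proof -
  let ?P = "product_topology (\<lambda>_. Y) (topspace X)"
  have AP: "A \<subseteq> topspace ?P"
    using assms unfolding Qp_def by auto
  have cl: "z \<in> Qp X Y closure_of A \<longleftrightarrow> z \<in> topspace (Qp X Y) \<and> z \<in> ?P closure_of A"
    using assms unfolding Qp_def closure_of_subtopology by (auto simp: Int_absorb1)
  have "z \<in> ?P closure_of A \<longleftrightarrow> ?R" if z: "z \<in> topspace (Qp X Y)"
  proof
    assume zc: "z \<in> ?P closure_of A"
    show ?R
    proof (intro allI impI)
      fix F V assume FV: "finite F \<and> F \<subseteq> topspace X \<and> (\<forall>x\<in>F. openin Y (V x) \<and> z x \<in> V x)"
      define T where "T = Pi\<^sub>E (topspace X) (\<lambda>x. if x \<in> F then V x else topspace Y)"
      have "openin ?P T"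
        unfolding T_def openin_PiE_gen
        using FV by (auto intro: finite_subset[of _ F])
      moreover have "z \<in> T"
        using z FV unfolding T_def in_topspace_Qp quasicontinuous_map_def by (auto simp: PiE_iff)
      ultimately obtain a where "a \<in> A" "a \<in> T"
        using zc unfolding in_closure_of by blast
      then show "\<exists>a\<in>A. \<forall>x\<in>F. a x \<in> V x"
        using FV unfolding T_def PiE_iff by (metis subsetD)
    qed
  next
    assume R: ?R
    show "z \<in> ?P closure_of A"
      unfolding in_closure_of
    proof (intro conjI allI impI)
      show "z \<in> topspace ?P"
        using z unfolding Qp_def by simp
      fix T assume T: "z \<in> T \<and> openin ?P T"
      then obtain V where V: "finite {i \<in> topspace X. V i \<noteq> topspace Y}"
        "\<And>i. i \<in> topspace X \<Longrightarrow> openin Y (V i)" "z \<in> Pi\<^sub>E (topspace X) V" "Pi\<^sub>E (topspace X) V \<subseteq> T"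
        unfolding openin_product_topology_alt by metis
      \<comment> \<open>These are the coordinates that the box really constrains; at all others
        membership holds because \<open>a\<close> takes values in \<open>topspace Y\<close>.\<close>
      let ?F = "{i \<in> topspace X. V i \<noteq> topspace Y}"
      obtain a where a: "a \<in> A" "\<And>x. x \<in> ?F \<Longrightarrow> a x \<in> V x"
        using R[rule_format, of ?F V] V by (auto simp: PiE_iff)
      moreover have "a \<in> Pi\<^sub>E (topspace X) V"
      proof -
        have "a \<in> extensional (topspace X)" "\<forall>x\<in>topspace X. a x \<in> topspace Y"
          using AP a(1) by (auto simp: PiE_iff)
        then show ?thesis
          using a(2) unfolding PiE_iff by (metis (mono_tags, lifting) mem_Collect_eq)
      qed
      ultimately show "\<exists>y. y \<in> A \<and> y \<in> T"
        using V by blast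
    qed
  qed
  then show ?thesis
    using cl by blast
qed

lemma in_closure_of_Qp_real:
  assumes "A \<subseteq> topspace (Qp X euclideanreal)"
  shows "z \<in> Qp X euclideanreal closure_of A \<longleftrightarrow> z \<in> topspace (Qp X euclideanreal) \<and>
    (\<forall>F e. finite F \<and> F \<subseteq> topspace X \<and> e > 0 \<longrightarrow> (\<exists>a\<in>A. \<forall>x\<in>F. \<bar>a x - z x\<bar> < e))"
    (is "_ \<longleftrightarrow> _ \<and> ?R")
proof -
  have "(\<forall>F V. finite F \<and> F \<subseteq> topspace X \<and> (\<forall>x\<in>F. openin euclideanreal (V x) \<and> z x \<in> V x) \<longrightarrow>
      (\<exists>a\<in>A. \<forall>x\<in>F. a x \<in> V x)) \<longleftrightarrow> ?R" (is "?L \<longleftrightarrow> _")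
  proof
    assume L: ?L
    show ?R
    proof (intro allI impI)
      fix F and e :: real assume "finite F \<and> F \<subseteq> topspace X \<and> e > 0"
      then show "\<exists>a\<in>A. \<forall>x\<in>F. \<bar>a x - z x\<bar> < e"
        using L[rule_format, of F "\<lambda>x. ball (z x) e"]
        by (auto simp: dist_real_def abs_minus_commute)
    qed
  next
    assume R: ?R
    show ?L
    proof (intro allI impI)
      fix F V assume FV: "finite F \<and> F \<subseteq> topspace X \<and> (\<forall>x\<in>F. openin euclideanreal (V x) \<and> z x \<in> V x)"
      then have "\<forall>x\<in>F. \<exists>e>0. \<forall>y. \<bar>y - z x\<bar> < e \<longrightarrow> y \<in> V x"
        by (simp add: open_real)
      then obtain e where e: "\<And>x. x \<in> F \<Longrightarrow> e x > 0"
        "\<And>x y. x \<in> F \<Longrightarrow> \<bar>y - z x\<bar> < e x \<Longrightarrow> y \<in> V x"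
        by metis
      \<comment> \<open>The element 1 makes the minimum positive also when \<open>F\<close> is
        empty.\<close>
      define d where "d = Min (insert 1 (e ` F))"
      have "d > 0" "\<And>x. x \<in> F \<Longrightarrow> d \<le> e x"
        using FV e by (auto simp: d_def)
      moreover obtain a where "a \<in> A" "\<forall>x\<in>F. \<bar>a x - z x\<bar> < d"
        using R FV \<open>d > 0\<close> by blast
      ultimately show "\<exists>a\<in>A. \<forall>x\<in>F. a x \<in> V x"
        using e(2) by (meson less_le_trans)
    qed
  qed
  then show ?thesis
    by (simp only: in_closure_of_Qp[OF assms])
qed

lemma in_closure_of_Qp_D2:
  assumes "A \<subseteq> topspace (Qp X D2)"
  shows "z \<in> Qp X D2 closure_of A \<longleftrightarrow> z \<in> topspace (Qp X D2) \<and>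
    (\<forall>F. finite F \<and> F \<subseteq> topspace X \<longrightarrow> (\<exists>a\<in>A. \<forall>x\<in>F. a x = z x))"
    (is "_ \<longleftrightarrow> _ \<and> ?R")
proof -
  have "(\<forall>F V. finite F \<and> F \<subseteq> topspace X \<and> (\<forall>x\<in>F. openin D2 (V x) \<and> z x \<in> V x) \<longrightarrow>
      (\<exists>a\<in>A. \<forall>x\<in>F. a x \<in> V x)) \<longleftrightarrow> ?R" (is "?L \<longleftrightarrow> _")
    if z: "z \<in> topspace (Qp X D2)"
  proof
    have zD: "z x \<in> {0, 1}" if "x \<in> topspace X" for x
      using z that unfolding in_topspace_Qp quasicontinuous_map_def D2_def by auto
    assume L: ?L
    show ?R
    proof (intro allI impI)
      fix F assume F: "finite F \<and> F \<subseteq> topspace X"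
      then have "\<forall>x\<in>F. openin D2 {z x} \<and> z x \<in> {z x}"
        using zD by (auto simp: D2_def)
      then show "\<exists>a\<in>A. \<forall>x\<in>F. a x = z x"
        using L[rule_format, of F "\<lambda>x. {z x}"] F by auto
    qed
  next
    assume R: ?R
    show ?L
    proof (intro allI impI)
      fix F V assume FV: "finite F \<and> F \<subseteq> topspace X \<and> (\<forall>x\<in>F. openin D2 (V x) \<and> z x \<in> V x)"
      then obtain a where "a \<in> A" "\<forall>x\<in>F. a x = z x"
        using R by blast
      then show "\<exists>a\<in>A. \<forall>x\<in>F. a x \<in> V x"
        using FV by (intro bexI[of _ a]) auto
    qed
  qed
  then show ?thesis
    unfolding in_closure_of_Qp[OF assms] by (rule conj_cong[OF refl])
qed

text \<open>The nonempty open \<open>W\<close> given by quasicontinuity lies in the preimage, hence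
  in its interior, which therefore meets every neighbourhood of \<open>x\<close>. This is the form
  in which quasicontinuity meets the hypothesis of \<open>open_whyburn_shrink\<close>.\<close>

lemma quasicontinuous_map_vimage_subset:
  assumes "quasicontinuous_map X Y f" "openin Y V"
  shows "{x \<in> topspace X. f x \<in> V} \<subseteq> X closure_of (X interior_of {x \<in> topspace X. f x \<in> V})"
proof
  fix x assume x: "x \<in> {x \<in> topspace X. f x \<in> V}"
  show "x \<in> X closure_of (X interior_of {x \<in> topspace X. f x \<in> V})"
    unfolding in_closure_of
  proof (intro conjI allI impI)
    show "x \<in> topspace X"
      using x by simp
    fix U assume "x \<in> U \<and> openin X U"
    then obtain W where W: "openin X W" "W \<noteq> {}" "W \<subseteq> U" "f ` W \<subseteq> V"
      using assms x unfolding quasicontinuous_map_def mem_Collect_eq by metis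
    then have "W \<subseteq> X interior_of {x \<in> topspace X. f x \<in> V}"
      using openin_subset by (intro interior_of_maximal) blast+
    then show "\<exists>y. y \<in> X interior_of {x \<in> topspace X. f x \<in> V} \<and> y \<in> U"
      using W by blast
  qed
qed

section \<open>Strong fan tightness at the zero function\<close>

lemma S1_K_Omega_imp_vet1_at_zero:
  assumes "regular_space X" "open_whyburn X" "S1 (K_Omega X) (K_Omega X)"
  shows "vet1_at (Qp X euclideanreal) (restrict (\<lambda>_. 0) (topspace X))"
  unfolding vet1_at_def
proof (intro allI impI)
  let ?Z = "Qp X euclideanreal" and ?z = "restrict (\<lambda>_. 0::real) (topspace X)"
  fix A :: "nat \<Rightarrow> ('a \<Rightarrow> real) set"
  assume A: "\<forall>n. A n \<subseteq> topspace ?Z \<and> ?z \<in> ?Z closure_of (A n)"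
  then have cl: "?z \<in> topspace ?Z"
    "\<exists>a\<in>A n. \<forall>x\<in>F. \<bar>a x - ?z x\<bar> < e" if "finite F" "F \<subseteq> topspace X" "e > 0" for n F e
    using in_closure_of_Qp_real[of "A n" X ?z] that by blast+
  \<comment> \<open>The tolerance shrinks with the stage. As each finite set is captured at
    arbitrarily late stages, the chosen functions become smaller there than any given
    \<open>e\<close>.\<close>
  define \<W> where "\<W> n = {U. openin X U \<and>
    (\<exists>f\<in>A n. \<forall>x\<in>X closure_of U. \<bar>f x\<bar> < inverse (Suc n))}" for n
  have "\<exists>W\<in>\<W> n. F \<subseteq> X closure_of W" if F: "finite F" "F \<subseteq> topspace X" for F n
  proof -
    obtain f where f: "f \<in> A n" "\<And>x. x \<in> F \<Longrightarrow> \<bar>f x - ?z x\<bar> < inverse (Suc n)"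
      using cl(2)[OF F, of "inverse (Suc n)" n] by auto
    \<comment> \<open>\<open>S\<close> is the preimage of a ball, so it lies in the closure of its
      interior. Shrinking that interior around \<open>F\<close> yields \<open>B\<close> whose
      closure contains \<open>F\<close> and stays in \<open>S\<close>.\<close>
    define S where "S = {x \<in> topspace X. f x \<in> ball 0 (inverse (Suc n))}"
    have "F \<subseteq> S"
    proof
      fix x assume "x \<in> F"
      then have "x \<in> topspace X" "\<bar>f x\<bar> < inverse (Suc n)"
        using f(2)[of x] F by auto
      then show "x \<in> S"
        by (simp add: S_def)
    qed
    moreover have "quasicontinuous_map X euclideanreal f"
      using A f(1) in_topspace_Qp by blast
    then have "S \<subseteq> X closure_of (X interior_of S)"
      unfolding S_def by (rule quasicontinuous_map_vimage_subset) simp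
    ultimately obtain B where B: "openin X B" "F \<subseteq> X closure_of B"
        "X closure_of B \<subseteq> X interior_of S \<union> F"
      using open_whyburn_shrink[OF assms(1,2) openin_interior_of F(1), of S] by (metis order_trans)
    then have "X closure_of B \<subseteq> S"
      using interior_of_subset[of X S] \<open>F \<subseteq> S\<close> by blast
    then have "\<forall>x\<in>X closure_of B. \<bar>f x\<bar> < inverse (Suc n)"
      unfolding S_def by auto
    then show ?thesis
      using B f(1) unfolding \<W>_def by blast
  qed
  then have "K_omega_family X (\<W> n)" for n
    unfolding K_omega_family_def \<W>_def by simp
  then obtain w where w: "\<And>n. w n \<in> \<W> n"
    and wF: "\<And>F m. finite F \<Longrightarrow> F \<subseteq> topspace X \<Longrightarrow> \<exists>n\<ge>m::nat. F \<subseteq> X closure_of (w n)"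
    using S1_K_Omega_select[OF assms(3)] by metis
  have "\<forall>n. \<exists>f. f \<in> A n \<and> (\<forall>x\<in>X closure_of (w n). \<bar>f x\<bar> < inverse (Suc n))"
    using w unfolding \<W>_def by blast
  then obtain f where f: "\<And>n. f n \<in> A n"
    "\<And>n x. x \<in> X closure_of (w n) \<Longrightarrow> \<bar>f n x\<bar> < inverse (Suc n)"
    by metis
  have "\<exists>a\<in>range f. \<forall>x\<in>F. \<bar>a x - ?z x\<bar> < e"
    if F: "finite F" "F \<subseteq> topspace X" "e > 0" for F e
  proof -
    obtain m where m: "inverse (Suc m) < e"
      using reals_Archimedean[OF \<open>e > 0\<close>] by auto
    obtain n where n: "n \<ge> m" "F \<subseteq> X closure_of (w n)"
      using wF[OF F(1,2)] by blast
    have "\<bar>f n x - ?z x\<bar> < e" if "x \<in> F" for x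
    proof -
      have "\<bar>f n x - ?z x\<bar> < inverse (Suc n)"
        using f(2)[of x n] n(2) that F(2) by auto
      also have "\<dots> \<le> inverse (Suc m)"
        using n(1) by (simp add: le_imp_inverse_le)
      finally show ?thesis
        using m by simp
    qed
    then show ?thesis by blast
  qed
  moreover have "range f \<subseteq> topspace ?Z"
    using f(1) A by blast
  ultimately have "?z \<in> ?Z closure_of (range f)"
    using cl(1)[of "{}" 1] in_closure_of_Qp_real[of "range f" X ?z] by simp
  with f(1) show "\<exists>a. (\<forall>n. a n \<in> A n) \<and> ?z \<in> ?Z closure_of (range a)"
    by blast
qed

text \<open>Every neighbourhood of a point of the closure meets the open set \<open>U\<close>, where
  the value is 0; off the closure the function is locally constant with value 1.\<close>

lemma quasicontinuous_map_indicator_compl_closure: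
  assumes "openin X U" "0 \<in> topspace Y" "1 \<in> topspace Y"
  shows "quasicontinuous_map X Y
    (restrict (\<lambda>x. if x \<in> X closure_of U then 0 else 1) (topspace X))"
    (is "quasicontinuous_map X Y ?f")
  unfolding quasicontinuous_map_def
proof (intro conjI ballI allI impI)
  show "?f ` topspace X \<subseteq> topspace Y"
    using assms by auto
  fix x V O' assume x: "x \<in> topspace X"
    and V: "openin Y V \<and> ?f x \<in> V \<and> openin X O' \<and> x \<in> O'"
  show "\<exists>W. openin X W \<and> W \<noteq> {} \<and> W \<subseteq> O' \<and> ?f ` W \<subseteq> V"
  proof (cases "x \<in> X closure_of U")
    case True
    then have "O' \<inter> U \<noteq> {}"
      using V unfolding in_closure_of by blast
    moreover have "U \<subseteq> X closure_of U" "U \<subseteq> topspace X"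
      using assms(1) by (simp_all add: closure_of_subset openin_subset)
    then have "?f ` (O' \<inter> U) \<subseteq> V"
      using True V x by auto
    ultimately show ?thesis
      using V assms(1) by (intro exI[of _ "O' \<inter> U"]) auto
  next
    case False
    have "openin X (O' - X closure_of U)"
      using V by (simp add: openin_diff)
    moreover have "O' \<subseteq> topspace X"
      using V by (simp add: openin_subset)
    then have "?f ` (O' - X closure_of U) \<subseteq> V"
      using False V x by auto
    ultimately show ?thesis
      using V False by (intro exI[of _ "O' - X closure_of U"]) auto
  qed
qed

text \<open>A general \<open>Y\<close> with an open \<open>V\<close> separating 0 from 1 serves both
  the reals and \<open>D2\<close>. An open set \<open>U\<close> is encoded as the function that is 0
  exactly on its closure: proximity to zero on \<open>F\<close> then means that \<open>F\<close>
  lies in this closure.\<close>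

lemma vet1_at_zero_imp_S1_K_Omega:
  fixes X :: "'a topology" and Y :: "'b::zero_neq_one topology"
  assumes Y: "0 \<in> topspace Y" "1 \<in> topspace Y" and V: "openin Y V" "0 \<in> V" "1 \<notin> V"
    and vet: "vet1_at (Qp X Y) (restrict (\<lambda>_. 0) (topspace X))"
  shows "S1 (K_Omega X) (K_Omega X)"
  unfolding S1_def
proof (intro allI impI)
  let ?z = "restrict (\<lambda>_. 0::'b) (topspace X)"
  fix A :: "nat \<Rightarrow> 'a set set"
  assume A: "\<forall>n. A n \<in> K_Omega X"
  define f :: "'a set \<Rightarrow> 'a \<Rightarrow> 'b"
    where "f U = restrict (\<lambda>x. if x \<in> X closure_of U then 0 else 1) (topspace X)" for U
  have fQ: "f U \<in> topspace (Qp X Y)" if "openin X U" for U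
    unfolding in_topspace_Qp f_def
    using quasicontinuous_map_indicator_compl_closure[OF that Y] by simp
  \<comment> \<open>The zero function encodes the whole space, which gives its
    quasicontinuity.\<close>
  have "?z = f (topspace X)"
    unfolding f_def by (auto simp: fun_eq_iff restrict_def)
  then have z: "?z \<in> topspace (Qp X Y)"
    using fQ[of "topspace X"] by simp
  have sub: "f ` A n \<subseteq> topspace (Qp X Y)" for n
    using fQ K_OmegaD(1)[OF A[rule_format]] by blast
  moreover have "?z \<in> Qp X Y closure_of (f ` A n)" for n
    unfolding in_closure_of_Qp[OF sub]
  proof (intro conjI allI impI)
    fix F T assume F: "finite F \<and> F \<subseteq> topspace X \<and> (\<forall>x\<in>F. openin Y (T x) \<and> ?z x \<in> T x)"
    then obtain U where U: "U \<in> A n" "F \<subseteq> X closure_of U"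
      using K_OmegaD(3)[OF A[rule_format]] by blast
    have "f U x \<in> T x" if "x \<in> F" for x
    proof -
      have "x \<in> topspace X" "x \<in> X closure_of U" "?z x \<in> T x"
        using F U(2) that by blast+
      then show ?thesis
        by (simp add: f_def)
    qed
    then show "\<exists>a\<in>f ` A n. \<forall>x\<in>F. a x \<in> T x"
      using U(1) by blast
  qed (rule z)
  ultimately obtain a where a: "\<And>n. a n \<in> f ` A n" and acl: "?z \<in> Qp X Y closure_of (range a)"
    using vet[unfolded vet1_at_def, rule_format, of "\<lambda>n. f ` A n"] by blast
  have "\<forall>n. \<exists>u. u \<in> A n \<and> a n = f u"
    using a by blast
  then obtain b where b: "\<And>n. b n \<in> A n" "\<And>n. a n = f (b n)"
    by metis
  have rs: "range a \<subseteq> topspace (Qp X Y)"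
    using a sub by blast
  have "\<exists>n. F \<subseteq> X closure_of (b n)" if F: "finite F" "F \<subseteq> topspace X" for F
  proof -
    \<comment> \<open>Since \<open>V\<close> omits 1, a value of \<open>a n\<close> in
      \<open>V\<close> must be 0, which puts the point into the closure of
      \<open>b n\<close>.\<close>
    have "\<forall>x\<in>F. openin Y V \<and> ?z x \<in> V"
      using F V by auto
    then obtain n where n: "\<And>x. x \<in> F \<Longrightarrow> a n x \<in> V"
      using acl[unfolded in_closure_of_Qp[OF rs], THEN conjunct2, rule_format, of F "\<lambda>_. V"] F
      by blast
    have "x \<in> X closure_of (b n)" if "x \<in> F" for x
    proof -
      have "x \<in> topspace X" "f (b n) x \<in> V"
        using n[OF that] F(2) that b(2) by auto
      then show ?thesis
        using V(3) by (auto simp: f_def split: if_splits)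
    qed
    then show ?thesis by blast
  qed
  moreover have "openin X (b n)" "X closure_of (b n) \<noteq> topspace X" for n
    using K_OmegaD(1,2)[OF A[rule_format] b(1)] by blast+
  ultimately have "range b \<in> K_Omega X"
    unfolding K_Omega_eq K_omega_family_def by simp
  with b(1) show "\<exists>b. (\<forall>n. b n \<in> A n) \<and> range b \<in> K_Omega X"
    by blast
qed

section \<open>Translation by continuous functions\<close>

text \<open>Sums of quasicontinuous functions can fail to be quasicontinuous. Here continuity first
  gives a neighbourhood \<open>U'\<close> on which \<open>f\<close> varies by less than
  \<open>e/2\<close>, and quasicontinuity of \<open>g\<close> is then applied inside
  \<open>U'\<close>.\<close>

lemma quasicontinuous_map_add_continuous:
  fixes f g :: "'a \<Rightarrow> real"
  assumes g: "quasicontinuous_map X euclideanreal g" and f: "continuous_map X euclideanreal f"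
  shows "quasicontinuous_map X euclideanreal (restrict (\<lambda>x. g x + f x) (topspace X))"
    (is "quasicontinuous_map X _ ?h")
  unfolding quasicontinuous_map_def
proof (intro conjI ballI allI impI)
  fix x V U assume x: "x \<in> topspace X"
    and V: "openin euclideanreal V \<and> ?h x \<in> V \<and> openin X U \<and> x \<in> U"
  then obtain e where e: "e > 0" "\<And>y. \<bar>y - (g x + f x)\<bar> < e \<Longrightarrow> y \<in> V"
    by (auto simp: open_real)
  define U' where "U' = U \<inter> {y \<in> topspace X. f y \<in> ball (f x) (e/2)}"
  have "openin X U'"
    unfolding U'_def using V openin_continuous_map_preimage[OF f, of "ball (f x) (e/2)"]
    by (intro openin_Int) auto
  moreover have "x \<in> U'"
    using x V e(1) by (simp add: U'_def)
  moreover have "openin euclideanreal (ball (g x) (e/2))" "g x \<in> ball (g x) (e/2)"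
    using e(1) by auto
  ultimately obtain W where W: "openin X W" "W \<noteq> {}" "W \<subseteq> U'" "g ` W \<subseteq> ball (g x) (e/2)"
    using g x unfolding quasicontinuous_map_def by metis
  have "?h y \<in> V" if "y \<in> W" for y
  proof -
    have y: "y \<in> topspace X" "\<bar>f y - f x\<bar> < e/2"
      using that W(3) by (auto simp: U'_def dist_real_def abs_minus_commute)
    moreover have "\<bar>g y - g x\<bar> < e/2"
      using that W(4) by (auto simp: dist_real_def abs_minus_commute)
    ultimately have "\<bar>(g y + f y) - (g x + f x)\<bar> < e"
      by linarith
    then show ?thesis
      using e(2) y(1) by simp
  qed
  then show "\<exists>W. openin X W \<and> W \<noteq> {} \<and> W \<subseteq> U \<and> ?h ` W \<subseteq> V"
    using W unfolding U'_def by blast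
qed simp

text \<open>Subtracting \<open>f\<close> moves \<open>f\<close> to zero and leaves all pointwise
  differences unchanged, so both closure statements carry over.\<close>

lemma vet1_at_zero_imp_vet1_at_continuous:
  assumes vet: "vet1_at (Qp X euclideanreal) (restrict (\<lambda>_. 0) (topspace X))"
    and f: "continuous_map X euclideanreal f"
  shows "vet1_at (Qp X euclideanreal) (restrict f (topspace X))"
  unfolding vet1_at_def
proof (intro allI impI)
  let ?Z = "Qp X euclideanreal" and ?z = "restrict (\<lambda>_. 0::real) (topspace X)"
    and ?f = "restrict f (topspace X)"
  fix A :: "nat \<Rightarrow> ('a \<Rightarrow> real) set"
  assume A: "\<forall>n. A n \<subseteq> topspace ?Z \<and> ?f \<in> ?Z closure_of (A n)"
  then have sA: "A n \<subseteq> topspace ?Z" and cA: "?f \<in> ?Z closure_of (A n)" for n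
    by simp_all
  define t where "t h g = restrict (\<lambda>x. g x + h x) (topspace X)" for g h :: "'a \<Rightarrow> real"
  have tQ: "t h g \<in> topspace ?Z"
    if "g \<in> topspace ?Z" "continuous_map X euclideanreal h" for g h
    using quasicontinuous_map_add_continuous that unfolding in_topspace_Qp t_def by auto
  have f': "continuous_map X euclideanreal (\<lambda>x. - f x)"
    using f by (rule continuous_map_minus)
  have fQ: "?f \<in> topspace ?Z"
    using cA by (meson in_closure_of)
  have "?z = t (\<lambda>x. - f x) ?f"
    unfolding t_def by (auto simp: fun_eq_iff)
  then have z: "?z \<in> topspace ?Z"
    using tQ[OF fQ f'] by simp
  have sub: "t (\<lambda>x. - f x) ` A n \<subseteq> topspace ?Z" for n
    using sA tQ[OF _ f'] by blast
  have "?z \<in> ?Z closure_of (t (\<lambda>x. - f x) ` A n)" for n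
    unfolding in_closure_of_Qp_real[OF sub]
  proof (intro conjI allI impI)
    fix F e assume F: "finite F \<and> F \<subseteq> topspace X \<and> (0::real) < e"
    then obtain a where a: "a \<in> A n" "\<And>x. x \<in> F \<Longrightarrow> \<bar>a x - ?f x\<bar> < e"
      using cA[of n, unfolded in_closure_of_Qp_real[OF sA], THEN conjunct2, rule_format, of F e]
      by metis
    have "\<bar>t (\<lambda>x. - f x) a x - ?z x\<bar> < e" if "x \<in> F" for x
      using a(2)[OF that] that F by (auto simp: t_def)
    then show "\<exists>a\<in>t (\<lambda>x. - f x) ` A n. \<forall>x\<in>F. \<bar>a x - ?z x\<bar> < e"
      using a(1) by blast
  qed (rule z)
  then obtain a where a: "\<And>n. a n \<in> t (\<lambda>x. - f x) ` A n" and acl: "?z \<in> ?Z closure_of (range a)"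
    using vet[unfolded vet1_at_def, rule_format, of "\<lambda>n. t (\<lambda>x. - f x) ` A n"] sub by blast
  have "\<forall>n. \<exists>g. g \<in> A n \<and> a n = t (\<lambda>x. - f x) g"
    using a by blast
  then obtain g where g: "\<And>n. g n \<in> A n" "\<And>n. a n = t (\<lambda>x. - f x) (g n)"
    by metis
  have ra: "range a \<subseteq> topspace ?Z" and rg: "range g \<subseteq> topspace ?Z"
    using a sub sA g(1) by blast+
  have "?f \<in> ?Z closure_of (range g)"
    unfolding in_closure_of_Qp_real[OF rg]
  proof (intro conjI allI impI)
    fix F e assume F: "finite F \<and> F \<subseteq> topspace X \<and> (0::real) < e"
    then obtain n where n: "\<And>x. x \<in> F \<Longrightarrow> \<bar>a n x - ?z x\<bar> < e"
      using acl[unfolded in_closure_of_Qp_real[OF ra], THEN conjunct2, rule_format, of F e]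
      by blast
    have "\<bar>g n x - ?f x\<bar> < e" if "x \<in> F" for x
      using n[OF that] that F by (auto simp: t_def g(2))
    then show "\<exists>a\<in>range g. \<forall>x\<in>F. \<bar>a x - ?f x\<bar> < e"
      by blast
  qed (rule fQ)
  with g(1) show "\<exists>a. (\<forall>n. a n \<in> A n) \<and> ?f \<in> ?Z closure_of (range a)"
    by blast
qed

section \<open>Two-valued functions\<close>

text \<open>Consider the open sets whose closure leaves \<open>D\<close> in finitely many points. As
  \<open>D\<close> is dense, it can be shrunk to such a set around any finite \<open>F\<close>. A
  selection covers the space by countably many closures, each contributing finitely many points
  outside \<open>D\<close>.\<close>

lemma S1_K_Omega_countable_nowhere_dense:
  assumes "regular_space X" "open_whyburn X" "S1 (K_Omega X) (K_Omega X)"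
    and D: "openin X D" "X closure_of D = topspace X"
  shows "countable (topspace X - D)"
proof -
  define \<W> where "\<W> = {U. openin X U \<and> finite (X closure_of U - D)}"
  have "\<exists>W\<in>\<W>. F \<subseteq> X closure_of W" if F: "finite F" "F \<subseteq> topspace X" for F
  proof -
    obtain B where B: "openin X B" "F \<subseteq> X closure_of B" "X closure_of B \<subseteq> D \<union> F"
      using open_whyburn_shrink[OF assms(1,2) D(1) F(1)] F(2) D(2) by metis
    then have "finite (X closure_of B - D)"
      by (intro finite_subset[OF _ F(1)]) blast
    then show ?thesis
      using B unfolding \<W>_def by blast
  qed
  then have "K_omega_family X \<W>"
    unfolding K_omega_family_def \<W>_def by simp
  then obtain w :: "nat \<Rightarrow> 'a set" where w: "\<And>n. w n \<in> \<W>"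
    and wF: "\<And>F m. finite F \<Longrightarrow> F \<subseteq> topspace X \<Longrightarrow> \<exists>n\<ge>m::nat. F \<subseteq> X closure_of (w n)"
    using S1_K_Omega_select[OF assms(3), of "\<lambda>_. \<W>"] by metis
  have "topspace X - D \<subseteq> (\<Union>n. X closure_of (w n) - D)"
  proof
    fix x assume "x \<in> topspace X - D"
    then show "x \<in> (\<Union>n. X closure_of (w n) - D)"
      using wF[of "{x}" 0] by auto
  qed
  moreover have "countable (\<Union>n. X closure_of (w n) - D)"
    using w by (intro countable_UN) (auto simp: \<W>_def countable_finite)
  ultimately show ?thesis
    by (rule countable_subset)
qed

lemma regular_space_finite_shrink:
  assumes "regular_space X" "openin X U" "finite F" "F \<subseteq> U"
  obtains V where "openin X V" "F \<subseteq> V" "X closure_of V \<subseteq> U"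
proof -
  have "\<forall>x\<in>F. \<exists>V. openin X V \<and> x \<in> V \<and> X closure_of V \<subseteq> U"
  proof
    fix x assume "x \<in> F"
    then have "x \<in> U"
      using assms(4) by blast
    then obtain V where "openin X V" "x \<in> V" "X closure_of V \<subseteq> U"
      by (rule regular_space_openin_shrink[OF assms(1,2)])
    then show "\<exists>V. openin X V \<and> x \<in> V \<and> X closure_of V \<subseteq> U"
      by blast
  qed
  then obtain V where V: "\<And>x. x \<in> F \<Longrightarrow> openin X (V x) \<and> x \<in> V x \<and> X closure_of (V x) \<subseteq> U"
    by metis
  have "X closure_of (\<Union>x\<in>F. V x) = (\<Union>x\<in>F. X closure_of (V x))"
    using closure_of_Union[of "V ` F" X] \<open>finite F\<close> by auto
  then show thesis
    using V by (intro that[of "\<Union>x\<in>F. V x"]) auto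
qed

text \<open>The members \<open>H \<union> Q\<close>, with \<open>H\<close> well inside \<open>P\<close>, have the common boundary of \<open>P\<close> and \<open>Q\<close>
  in their closure without coming near it inside \<open>P\<close>.\<close>

lemma S1_K_Omega_exhaustion:
  assumes "regular_space X" "S1 (K_Omega X) (K_Omega X)"
    and P: "openin X P" and Q: "openin X Q" and PQ: "P \<inter> Q = {}" "topspace X - P \<subseteq> X closure_of Q"
  obtains G :: "nat \<Rightarrow> 'a set" where "\<And>n. openin X (G n)" "\<And>n. X closure_of (G n) \<subseteq> P"
    and "P \<subseteq> (\<Union>n. G n)"
proof -
  define \<W> where "\<W> = {U. openin X U \<and>
    (\<exists>G. openin X G \<and> X closure_of G \<subseteq> P \<and> P \<inter> X closure_of U \<subseteq> G)}"
  have "\<exists>W\<in>\<W>. F \<subseteq> X closure_of W" if F: "finite F" "F \<subseteq> topspace X" for F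
  proof -
    \<comment> \<open>Two shrinkings are made: \<open>G\<close> must have its closure inside
      \<open>P\<close>, and must itself contain the closure of \<open>H\<close>.\<close>
    obtain G where G: "openin X G" "F \<inter> P \<subseteq> G" "X closure_of G \<subseteq> P"
      by (rule regular_space_finite_shrink[OF assms(1) P, of "F \<inter> P"]) (use F(1) in auto)
    obtain H where H: "openin X H" "F \<inter> P \<subseteq> H" "X closure_of H \<subseteq> G"
      by (rule regular_space_finite_shrink[OF assms(1) G(1) _ G(2)]) (use F(1) in auto)
    have "P \<inter> X closure_of Q = {}"
      using PQ(1) P by (simp add: openin_Int_closure_of_eq_empty)
    then have "P \<inter> X closure_of (H \<union> Q) \<subseteq> G"
      using H(3) by auto
    moreover have "H \<subseteq> X closure_of H"
      using H(1) by (simp add: closure_of_subset openin_subset)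
    then have "F \<subseteq> X closure_of (H \<union> Q)"
      using F(2) H(2) PQ(2) by auto
    ultimately show ?thesis
      using G H(1) Q unfolding \<W>_def by (intro bexI[of _ "H \<union> Q"]) auto
  qed
  then have "K_omega_family X \<W>"
    unfolding K_omega_family_def \<W>_def by simp
  then obtain w :: "nat \<Rightarrow> 'a set" where w: "\<And>n. w n \<in> \<W>"
    and wF: "\<And>F m. finite F \<Longrightarrow> F \<subseteq> topspace X \<Longrightarrow> \<exists>n\<ge>m::nat. F \<subseteq> X closure_of (w n)"
    using S1_K_Omega_select[OF assms(2), of "\<lambda>_. \<W>"] by metis
  have "\<forall>n. \<exists>G. openin X G \<and> X closure_of G \<subseteq> P \<and> P \<inter> X closure_of (w n) \<subseteq> G"
    using w unfolding \<W>_def by blast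
  then obtain G where G: "\<And>n. openin X (G n)" "\<And>n. X closure_of (G n) \<subseteq> P"
    "\<And>n. P \<inter> X closure_of (w n) \<subseteq> G n"
    by metis
  have "P \<subseteq> (\<Union>n. G n)"
  proof
    fix x assume x: "x \<in> P"
    then have "x \<in> topspace X"
      using P openin_subset by blast
    then obtain n where "x \<in> X closure_of (w n)"
      using wF[of "{x}" 0] by auto
    then show "x \<in> (\<Union>n. G n)"
      using G(3)[of n] x by blast
  qed
  with G(1,2) show thesis
    by (rule that)
qed

lemma S1_K_Omega_imp_vet1_D2:
  assumes reg: "regular_space X" and why: "open_whyburn X" and S1: "S1 (K_Omega X) (K_Omega X)"
  shows "vet1 (Qp X D2)"
  unfolding vet1_def vet1_at_def
proof (intro ballI allI impI)
  fix f :: "'a \<Rightarrow> real" and A :: "nat \<Rightarrow> ('a \<Rightarrow> real) set"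
  assume fQ: "f \<in> topspace (Qp X D2)"
    and A: "\<forall>n. A n \<subseteq> topspace (Qp X D2) \<and> f \<in> Qp X D2 closure_of (A n)"
  then have sA: "A n \<subseteq> topspace (Qp X D2)" and cA: "f \<in> Qp X D2 closure_of (A n)" for n
    by simp_all
  have cl: "\<exists>a\<in>A n. \<forall>x\<in>F. a x = f x" if "finite F" "F \<subseteq> topspace X" for n F
    using cA[of n, unfolded in_closure_of_Qp_D2[OF sA], THEN conjunct2, rule_format, of F] that
    by simp
  define L where "L g c = X interior_of {x \<in> topspace X. g x \<in> {c}}" for g :: "'a \<Rightarrow> real" and c
  have L_open: "openin X (L g c)" and L_eq: "\<And>x. x \<in> L g c \<Longrightarrow> g x = c" for g c
    using interior_of_subset[of X "{x \<in> topspace X. g x \<in> {c}}"] by (auto simp: L_def)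
  have L_cl: "x \<in> X closure_of (L g (g x))" and D2_val: "g x = 0 \<or> g x = 1"
    if "g \<in> topspace (Qp X D2)" "x \<in> topspace X" for g x
  proof -
    have g: "quasicontinuous_map X D2 g"
      using that(1) by (simp add: in_topspace_Qp)
    then have "g x \<in> topspace D2"
      using that(2) unfolding quasicontinuous_map_def by blast
    then show "g x = 0 \<or> g x = 1"
      by (auto simp: D2_def)
    then have "openin D2 {g x}"
      by (auto simp: D2_def)
    then show "x \<in> X closure_of (L g (g x))"
      using quasicontinuous_map_vimage_subset[OF g, of "{g x}"] that(2) by (auto simp: L_def)
  qed
  define P Q where "P = L f 1" and "Q = L f 0"
  have fP: "f x = 1" if "x \<in> P" for x
    using L_eq[of x f 1] that by (simp add: P_def)
  have fQ0: "f x = 0" if "x \<in> Q" for x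
    using L_eq[of x f 0] that by (simp add: Q_def)
  have "P \<inter> Q = {}"
    using fP fQ0 by (metis disjoint_iff zero_neq_one)
  then have PQ: "openin X P" "openin X Q" "P \<inter> Q = {}"
    using L_open by (simp_all add: P_def Q_def)
  have PQ_cl: "x \<in> X closure_of P \<or> x \<in> X closure_of Q" if "x \<in> topspace X" for x
    using L_cl[OF fQ that] D2_val[OF fQ that] by (auto simp: P_def Q_def)
  \<comment> \<open>Arbitrarily near a point outside the interior of \<open>{f = c}\<close> the
    other value \<open>d\<close> is taken, and each point with value \<open>d\<close> is in the
    closure of \<open>L f d\<close>.\<close>
  have bd: "topspace X - L f c \<subseteq> X closure_of (L f d)" if cd: "{c, d} = {0, 1}" for c d
  proof
    fix x assume x: "x \<in> topspace X - L f c"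
    show "x \<in> X closure_of (L f d)"
      unfolding in_closure_of
    proof (intro conjI allI impI)
      fix T assume T: "x \<in> T \<and> openin X T"
      then have "T \<subseteq> topspace X"
        by (simp add: openin_subset)
      have "\<not> T \<subseteq> {x \<in> topspace X. f x \<in> {c}}"
        using T x interior_of_maximal[of T "{x \<in> topspace X. f x \<in> {c}}" X] unfolding L_def by blast
      then obtain y where y: "y \<in> T" "f y \<noteq> c"
        using \<open>T \<subseteq> topspace X\<close> by blast
      then have "f y = d"
        using D2_val[OF fQ, of y] cd \<open>T \<subseteq> topspace X\<close> by (auto simp: doubleton_eq_iff)
      then have "y \<in> X closure_of (L f d)"
        using L_cl[OF fQ, of y] y \<open>T \<subseteq> topspace X\<close> by blast
      then show "\<exists>y. y \<in> L f d \<and> y \<in> T"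
        using T y(1) unfolding in_closure_of by blast
    qed (use x in blast)
  qed
  have "Q \<inter> P = {}" and bdPQ: "topspace X - P \<subseteq> X closure_of Q" "topspace X - Q \<subseteq> X closure_of P"
    using PQ(3) bd[of 1 0] bd[of 0 1] by (auto simp: P_def Q_def)
  obtain G where G: "\<And>n. openin X (G n)" "\<And>n. X closure_of (G n) \<subseteq> P" "P \<subseteq> (\<Union>n::nat. G n)"
    using S1_K_Omega_exhaustion[OF reg S1 PQ bdPQ(1)] by metis
  obtain H where H: "\<And>n. openin X (H n)" "\<And>n. X closure_of (H n) \<subseteq> Q" "Q \<subseteq> (\<Union>n::nat. H n)"
    using S1_K_Omega_exhaustion[OF reg S1 PQ(2,1) \<open>Q \<inter> P = {}\<close> bdPQ(2)] by metis
  define E where "E n = (\<Union>k<n. G k \<union> H k)" for n :: nat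
  have E_open: "openin X (E n)" for n
    using G(1) H(1) unfolding E_def by auto
  have E_cl: "X closure_of (E n) \<subseteq> P \<union> Q" for n
  proof -
    have "X closure_of (E n) = (\<Union>k<n. X closure_of (G k \<union> H k))"
      using closure_of_Union[of "(\<lambda>k. G k \<union> H k) ` {..<n}" X] by (auto simp: E_def)
    then show ?thesis
      using G(2) H(2) by fastforce
  qed
  define N where "N = topspace X - (P \<union> Q)"
  have "countable N"
    unfolding N_def
  proof (rule S1_K_Omega_countable_nowhere_dense[OF reg why S1])
    show "openin X (P \<union> Q)"
      using PQ by blast
    show "X closure_of (P \<union> Q) = topspace X"
      using PQ_cl closure_of_subset_topspace[of X "P \<union> Q"] by auto
  qed
  \<comment> \<open>\<open>M n\<close> is an increasing sequence of finite sets exhausting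
    \<open>N\<close>.\<close>
  define M where "M n = {x \<in> N. to_nat_on N x < n}" for n
  have M_fin: "finite (M n)" for n
  proof (rule finite_imageD)
    show "finite (to_nat_on N ` M n)"
      by (rule finite_subset[of _ "{..<n}"]) (auto simp: M_def)
    show "inj_on (to_nat_on N) (M n)"
      using inj_on_to_nat_on[OF \<open>countable N\<close>] by (rule inj_on_subset) (auto simp: M_def)
  qed
  define \<W> where "\<W> n = {W. openin X W \<and>
    (\<exists>g\<in>A n. \<forall>x \<in> M n \<union> (X closure_of W \<inter> E n). g x = f x)}" for n
  have "\<exists>W\<in>\<W> n. F \<subseteq> X closure_of W" if F: "finite F" "F \<subseteq> topspace X" for F n
  proof -
    \<comment> \<open>Enlarging \<open>F\<close> by \<open>M n\<close> before approximating
      \<open>f\<close> gives the outright agreement on \<open>M n\<close>.\<close>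
    have "finite (F \<union> M n)" "F \<union> M n \<subseteq> topspace X"
      using F M_fin by (auto simp: M_def N_def)
    then obtain g where g: "g \<in> A n" "\<And>x. x \<in> F \<union> M n \<Longrightarrow> g x = f x"
      using cl by metis
    have gQ: "g \<in> topspace (Qp X D2)"
      using sA g(1) by blast
    \<comment> \<open>On \<open>S\<close> both functions are locally constant with the same value.
      Because \<open>P\<close> and \<open>Q\<close> are open, a point of \<open>P\<close> or
      \<open>Q\<close> where \<open>g\<close> agrees with \<open>f\<close> is in the closure of
      \<open>S\<close>; at points of \<open>N\<close> this can fail, so only
      \<open>F \<inter> (P \<union> Q)\<close> is treated through \<open>S\<close>.\<close>
    define S where "S = (P \<inter> L g 1) \<union> (Q \<inter> L g 0)"
    have S: "openin X S" "\<And>x. x \<in> S \<Longrightarrow> g x = f x"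
      using PQ L_open L_eq[of _ g] fP fQ0 unfolding S_def by (blast, metis Int_iff Un_iff)
    have "F \<inter> (P \<union> Q) \<subseteq> X closure_of S"
    proof
      fix x assume x: "x \<in> F \<inter> (P \<union> Q)"
      then have gx: "x \<in> X closure_of (L g (f x))"
        using L_cl[OF gQ, of x] g(2)[of x] F(2) by auto
      have "X closure_of (P \<inter> L g 1) \<subseteq> X closure_of S" "X closure_of (Q \<inter> L g 0) \<subseteq> X closure_of S"
        by (auto simp: S_def intro: closure_of_mono)
      moreover have "x \<in> X closure_of (P \<inter> L g 1)" if "x \<in> P"
        using that gx fP[OF that] openin_Int_closure_of_subset[OF PQ(1), of "L g 1"] by auto
      moreover have "x \<in> X closure_of (Q \<inter> L g 0)" if "x \<in> Q"
        using that gx fQ0[OF that] openin_Int_closure_of_subset[OF PQ(2), of "L g 0"] by auto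
      ultimately show "x \<in> X closure_of S"
        using x by blast
    qed
    then obtain B where B: "openin X B" "F \<inter> (P \<union> Q) \<subseteq> X closure_of B"
      "X closure_of B \<subseteq> S \<union> F \<inter> (P \<union> Q)"
      using open_whyburn_shrink[OF reg why S(1) finite_Int[OF disjI1[OF F(1)]]] by metis
    \<comment> \<open>\<open>V\<close> contains \<open>N\<close>, since the closure of
      \<open>E n\<close> avoids \<open>N\<close>, and the closure of \<open>V\<close> misses the
      open set \<open>E n\<close>. Adding \<open>V\<close> to \<open>B\<close> thus captures the
      remaining points of \<open>F\<close> without demanding further agreement.\<close>
    define V where "V = topspace X - X closure_of (E n)"
    have V: "openin X V"
      by (simp add: V_def openin_diff)
    have "E n \<subseteq> X closure_of (E n)"
      using E_open by (simp add: closure_of_subset openin_subset)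
    then have VE: "E n \<inter> X closure_of V = {}"
      using openin_Int_closure_of_eq_empty[OF E_open, of n V] by (auto simp: V_def)
    have "V \<subseteq> X closure_of V"
      using V by (simp add: closure_of_subset openin_subset)
    then have "F \<subseteq> X closure_of (B \<union> V)"
      using B(2) F(2) E_cl[of n] by (auto simp: V_def)
    moreover have "g x = f x" if "x \<in> M n \<union> (X closure_of (B \<union> V) \<inter> E n)" for x
    proof (cases "x \<in> M n")
      case False
      then have "x \<in> X closure_of B"
        using that VE by auto
      then show ?thesis
        using B(3) S(2) g(2) by blast
    qed (use g(2) in blast)
    ultimately show ?thesis
      using B(1) V g(1) unfolding \<W>_def by blast
  qed
  then have "K_omega_family X (\<W> n)" for n
    unfolding K_omega_family_def \<W>_def by simp
  then obtain w where w: "\<And>n. w n \<in> \<W> n"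
    and wF: "\<And>F m. finite F \<Longrightarrow> F \<subseteq> topspace X \<Longrightarrow> \<exists>n\<ge>m::nat. F \<subseteq> X closure_of (w n)"
    using S1_K_Omega_select[OF S1] by metis
  have "\<forall>n. \<exists>g. g \<in> A n \<and> (\<forall>x \<in> M n \<union> (X closure_of (w n) \<inter> E n). g x = f x)"
    using w unfolding \<W>_def by blast
  then obtain a where a: "\<And>n. a n \<in> A n"
    "\<And>n x. x \<in> M n \<union> (X closure_of (w n) \<inter> E n) \<Longrightarrow> a n x = f x"
    by metis
  have ra: "range a \<subseteq> topspace (Qp X D2)"
    using a(1) sA by blast
  have "f \<in> Qp X D2 closure_of (range a)"
    unfolding in_closure_of_Qp_D2[OF ra]
  proof (intro conjI allI impI)
    fix F assume F: "finite F \<and> F \<subseteq> topspace X"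
    \<comment> \<open>Every point enters \<open>M n\<close> or \<open>E n\<close> for good: the
      bounds in \<open>M\<close> and \<open>E\<close> are strict, hence the successors as
      thresholds. A stage past the thresholds of all points of \<open>F\<close> that also captures
      \<open>F\<close> gives agreement on \<open>F\<close>.\<close>
    have "\<exists>k. \<forall>n\<ge>k. x \<in> M n \<union> E n" if x: "x \<in> topspace X" for x
    proof (cases "x \<in> N")
      case True
      then show ?thesis
        by (intro exI[of _ "Suc (to_nat_on N x)"]) (auto simp: M_def)
    next
      case False
      then obtain k where "x \<in> G k \<union> H k"
        using x G(3) H(3) unfolding N_def by blast
      then show ?thesis
        by (intro exI[of _ "Suc k"]) (auto simp: E_def)
    qed
    then obtain k where k: "\<And>x n. x \<in> topspace X \<Longrightarrow> n \<ge> k x \<Longrightarrow> x \<in> M n \<union> E n"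
      by metis
    obtain n where n: "n \<ge> Max (insert 0 (k ` F))" "F \<subseteq> X closure_of (w n)"
      using wF F by blast
    have "a n x = f x" if "x \<in> F" for x
    proof -
      have "k x \<le> n"
        using n(1) F that by auto
      then have "x \<in> M n \<union> E n"
        using k that F by blast
      then show ?thesis
        using a(2) n(2) that by blast
    qed
    then show "\<exists>a\<in>range a. \<forall>x\<in>F. a x = f x"
      by blast
  qed (rule fQ)
  with a(1) show "\<exists>a. (\<forall>n. a n \<in> A n) \<and> f \<in> Qp X D2 closure_of (range a)"
    by blast
qed

lemma vet1_D2_imp_S1_K_Omega:
  assumes "vet1 (Qp X D2)"
  shows "S1 (K_Omega X) (K_Omega X)"
proof (rule vet1_at_zero_imp_S1_K_Omega)
  have "restrict (\<lambda>_. 0) (topspace X) \<in> topspace (Qp X D2)"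
    by (auto simp: in_topspace_Qp quasicontinuous_map_def D2_def)
  then show "vet1_at (Qp X D2) (restrict (\<lambda>_. 0) (topspace X))"
    using assms unfolding vet1_def by blast
  show "openin D2 {0}"
    by (simp add: D2_def)
qed (auto simp: D2_def)

theorem theorem4p1:
  fixes X :: "'a topology"
  assumes "regular_space X" and "t1_space X"
    and "uncountable (topspace X)"
    and "open_whyburn X"
  shows "(S1 (Omega_s X) (Omega_s X) \<longleftrightarrow> S1 (K_Omega X) (K_Omega X))
       \<and> (S1 (K_Omega X) (K_Omega X) \<longleftrightarrow> vet1_at (Qp X euclideanreal) (restrict (\<lambda>_. 0) (topspace X)))
       \<and> (vet1_at (Qp X euclideanreal) (restrict (\<lambda>_. 0) (topspace X)) \<longleftrightarrow>
            (\<forall>f. continuous_map X euclideanreal f \<longrightarrow>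
                 vet1_at (Qp X euclideanreal) (restrict f (topspace X))))
       \<and> ((\<forall>f. continuous_map X euclideanreal f \<longrightarrow>
                 vet1_at (Qp X euclideanreal) (restrict f (topspace X))) \<longleftrightarrow>
            vet1 (Qp X D2))"
proof -
  let ?S = "S1 (K_Omega X) (K_Omega X)"
    and ?V0 = "vet1_at (Qp X euclideanreal) (restrict (\<lambda>_. 0) (topspace X))"
    and ?VC = "\<forall>f. continuous_map X euclideanreal f \<longrightarrow>
      vet1_at (Qp X euclideanreal) (restrict f (topspace X))"
  have "S1 (Omega_s X) (Omega_s X) \<longleftrightarrow> ?S"
    using S1_Omega_s_imp_K_Omega S1_K_Omega_imp_Omega_s[OF assms(1,4)] by blast
  moreover have "?V0 \<Longrightarrow> ?S"
    \<comment> \<open>The open unit ball around 0 does not contain 1.\<close>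
    by (rule vet1_at_zero_imp_S1_K_Omega[where V = "ball 0 1"]) auto
  then have "?S \<longleftrightarrow> ?V0"
    using S1_K_Omega_imp_vet1_at_zero[OF assms(1,4)] by blast
  moreover have "?V0 \<longleftrightarrow> ?VC"
  proof
    assume ?V0
    then show ?VC
      using vet1_at_zero_imp_vet1_at_continuous by blast
  next
    assume C: ?VC
    show ?V0
      by (rule C[rule_format]) simp
  qed
  moreover have "?S \<longleftrightarrow> vet1 (Qp X D2)"
    using S1_K_Omega_imp_vet1_D2[OF assms(1,4)] vet1_D2_imp_S1_K_Omega by blast
  ultimately show ?thesis
    by (simp only: simp_thms)
qed

end
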